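(* Let $R$ be a finite rack, $G$ any group structure on the underlying set of $R$, and consider the crossed module $(\mathrm{id}\colon G\to G,\mathrm{ad})$ ($G$ acting on itself by conjugation) with the framed Reidemeister pair $\Phi=(\psi,\phi)$, $$\psi(B,A)=B\,A\,B^{-1}(B\triangleright A)^{-1},\qquad \phi(B,A)=A\,B\,(A\triangleleft B)^{-1}B^{-1}.$$ Then for every oriented link diagram $D$, $$I_\Phi(D)=I_R(D)\,1_G,$$ where $I_R(D)$ is the number of rack colourings of $D$ by $R$ and $1_G$ is the identity of $G$. Consequently the class of invariants $I_\Phi$ obtained from crossed modules with Reidemeister pairs is at least as strong as the class of rack link invariants $I_R$.
   Context: A rack is a set $R$ with operations $\triangleright,\triangleleft$ such that for all $x,y,z$: $x\triangleright(y\triangleleft x)=y$; $(x\triangleright y)\triangleleft x=y$; $x\triangleright(y\triangleright z)=(x\triangleright y)\triangleright(x\triangleright z)$; $(x\triangleleft y)\triangleleft z=(x\triangleleft z)\triangleleft(y\triangleleft z)$. Link diagrams are drawn as sliced diagrams: horizontal strips, each containing vertical lines and at most one cup, cap, or crossing $X_+$ or $X_-$. In $X_+$ both strands point down, the over strand runs from top right to bottom left and the under strand from top left to bottom right. In $X_-$ both strands point down, the over strand runs from top left to bottom right and the under strand from top right to bottom left. A rack colouring assigns elements of $R$ to arcs so that: at an $X_+$ with over arc $y$ and bottom-right under arc $x$, the top-left under arc is $y\triangleright x$; at an $X_-$ with over arc $y$ and bottom-left under arc $x$, the top-right under arc is $x\triangleleft y$. For a crossed module $(\mu\colon P\to H,\cdot)$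 (group morphism $\mu$ with left action of $H$ on $P$ by automorphisms, $\mu(g\cdot e)=g\mu(e)g^{-1}$, $\mu(e)\cdot f=efe^{-1}$), $H$ finite, and functions $\psi,\phi\colon H\times H\to P$, a Reidemeister colouring $F$ of a diagram assigns elements of $H$ to arcs and elements of $P$ to crossings so that: at an $X_+$ with over arc $X$, bottom-right under arc $Y$, top-left under arc $Z$, the crossing carries $\psi(X,Y)$ and $Z=\mu(\psi(X,Y))^{-1}XYX^{-1}$; at an $X_-$ with over arc $X$, bottom-left under arc $Y$, top-right under arc $Z$, the crossing carries $\phi(X,Y)$ and $Z=X^{-1}\mu(\phi(X,Y))^{-1}YX$. The associated monoidal category has objects the elements of $H$, morphisms $U\xrightarrow{e}V$ with $e\in P$, $\mu(e)U=V$, composition $U\xrightarrow{e}V\xrightarrow{f}W=U\xrightarrow{fe}W$, and tensor product $(U\xrightarrow{e}V)\otimes(U'\xrightarrow{e'}V')=(UU'\xrightarrow{(V\cdot e')e}VV')$. The evaluation $e(F)$ is the morphism obtained by tensoring horizontally and composing vertically (top to bottom), where $X_+$ gives $ZX\xrightarrow{\psi(X,Y)}XY$, $X_-$ gives $XZ\xrightarrow{\phi(X,Y)}YX$, vertical strands coloured $X$ give identities of $X$ (downwards) or $X^{-1}$ (upwards), and cups and caps give the morphisms with element $1_P$. For a link diagram $e(F)$ is a morphism $1_H\to1_H$, i.e. an element of $\ker\mu$, and $I_\Phi(D)=\sum_F e(F)\in\mathbb{Z}[\ker\mu]$. The pair $\Phi$ is called a framed Reidemeister pair when it satisfies the algebraic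 conditions: for all $X,Y,T\in H$, (R2) $\phi(X,Y)\psi(X,Z)=1$ with $Z=X^{-1}\mu(\phi(X,Y))^{-1}YX$; (R3) $\phi(Y,X)(Y\cdot\phi(T,Z))\phi(T,Y)=(X\cdot\phi(T,Y))\phi(T,X)(T\cdot\phi(V,W))$ with $Z=Y^{-1}\mu(\phi(Y,X))^{-1}XY$, $V=T^{-1}\mu(\phi(T,Y))^{-1}YT$, $W=T^{-1}\mu(\phi(T,X))^{-1}XT$; for each $Z\in H$ the equation $\mu(\phi(A,Z))A=Z$ has a unique solution $A=f(Z)$, and $f$ is the two-sided inverse of $g(A)=\mu(\psi(A,A))^{-1}A$. *)

theory Defs
  imports "HOL-Algebra.Bij" "HOL-Algebra.Free_Abelian_Groups"
begin

section \<open>Racks\<close>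

locale rack =
  fixes R :: "'a set"
    and rk :: "'a \<Rightarrow> 'a \<Rightarrow> 'a" (infixl \<open>\<triangleright>\<close> 70)
    and lk :: "'a \<Rightarrow> 'a \<Rightarrow> 'a" (infixl \<open>\<triangleleft>\<close> 70)
  assumes rk_closed: "x \<in> R \<Longrightarrow> y \<in> R \<Longrightarrow> x \<triangleright> y \<in> R"
    and lk_closed: "x \<in> R \<Longrightarrow> y \<in> R \<Longrightarrow> x \<triangleleft> y \<in> R"
    and rk_lk: "x \<in> R \<Longrightarrow> y \<in> R \<Longrightarrow> x \<triangleright> (y \<triangleleft> x) = y"
    and lk_rk: "x \<in> R \<Longrightarrow> y \<in> R \<Longrightarrow> (x \<triangleright> y) \<triangleleft> x = y"
    and rk_distrib: "x \<in> R \<Longrightarrow> y \<in> R \<Longrightarrow> z \<in> R \<Longrightarrow>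
      x \<triangleright> (y \<triangleright> z) = (x \<triangleright> y) \<triangleright> (x \<triangleright> z)"
    and lk_distrib: "x \<in> R \<Longrightarrow> y \<in> R \<Longrightarrow> z \<in> R \<Longrightarrow>
      (x \<triangleleft> y) \<triangleleft> z = (x \<triangleleft> z) \<triangleleft> (y \<triangleleft> z)"


section \<open>Oriented sliced link diagrams\<close>

datatype orientation = Down | Up

fun opposite :: "orientation \<Rightarrow> orientation" where
  "opposite Down = Up"
| "opposite Up = Down"

text \<open>
  The argument of a cup or a cap is the orientation of its left end; the right end has the
  opposite orientation. A cup has both ends on the top edge of its strip, a cap has both ends
  on the bottom edge. \<open>X_pos\<close> and \<open>X_neg\<close> are the crossings with both strands pointing down;
  in \<open>X_pos\<close> the over strand runs from top right to bottom left, in \<open>X_neg\<close> from top left to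
  bottom right.
\<close>

datatype piece =
    Vertical orientation
  | Cup orientation
  | Cap orientation
  | X_pos
  | X_neg

fun top_ends :: "piece \<Rightarrow> orientation list" where
  "top_ends (Vertical s) = [s]"
| "top_ends (Cup s) = [s, opposite s]"
| "top_ends (Cap s) = []"
| "top_ends X_pos = [Down, Down]"
| "top_ends X_neg = [Down, Down]"

fun bottom_ends :: "piece \<Rightarrow> orientation list" where
  "bottom_ends (Vertical s) = [s]"
| "bottom_ends (Cup s) = []"
| "bottom_ends (Cap s) = [s, opposite s]"
| "bottom_ends X_pos = [Down, Down]"
| "bottom_ends X_neg = [Down, Down]"

text \<open>A strip lists its pieces from left to right, a diagram lists its strips from top to bottom.\<close>

type_synonym strip = "piece list"
type_synonym diagram = "strip list"

definition strip_top :: "strip \<Rightarrow> orientation list" where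
  "strip_top s = concat (map top_ends s)"

definition strip_bottom :: "strip \<Rightarrow> orientation list" where
  "strip_bottom s = concat (map bottom_ends s)"

definition is_strip :: "strip \<Rightarrow> bool" where
  "is_strip s \<longleftrightarrow> length (filter (\<lambda>p. p \<notin> range Vertical) s) \<le> 1"

definition link_diagram :: "diagram \<Rightarrow> bool" where
  "link_diagram D \<longleftrightarrow>
     (\<forall>s \<in> set D. is_strip s) \<and>
     (\<forall>i. Suc i < length D \<longrightarrow> strip_bottom (D ! i) = strip_top (D ! Suc i)) \<and>
     (D \<noteq> [] \<longrightarrow> strip_top (hd D) = [] \<and> strip_bottom (last D) = [])"


section \<open>Arcs\<close>

text \<open>
  The point \<open>(i, j)\<close> is the \<open>j\<close>-th point from the left, counting from \<open>0\<close>, in which the diagram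
  meets the top edge of strip \<open>i\<close>; for \<open>i > 0\<close> this is also the bottom edge of strip \<open>i - 1\<close>.
  Nothing meets the bottom edge of the last strip of a link diagram, so every arc of a link
  diagram passes through at least one of these points.
\<close>

type_synonym point = "nat \<times> nat"

definition points :: "diagram \<Rightarrow> point set" where
  "points D = {(i, j). i < length D \<and> j < length (strip_top (D ! i))}"

text \<open>The \<open>a\<close>-th top end and the \<open>a\<close>-th bottom end of the \<open>k\<close>-th piece of strip \<open>i\<close>.\<close>

definition top_pt :: "diagram \<Rightarrow> nat \<Rightarrow> nat \<Rightarrow> nat \<Rightarrow> point" where
  "top_pt D i k a = (i, length (strip_top (take k (D ! i))) + a)"

definition bot_pt :: "diagram \<Rightarrow> nat \<Rightarrow> nat \<Rightarrow> nat \<Rightarrow> point" where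
  "bot_pt D i k a = (Suc i, length (strip_bottom (take k (D ! i))) + a)"

text \<open>
  Two ends of a piece are joined if the piece connects them; at a crossing only the over strand
  connects its two ends, since the under strand is broken there.
\<close>

inductive joined :: "diagram \<Rightarrow> point \<Rightarrow> point \<Rightarrow> bool" for D where
  vertical: "i < length D \<Longrightarrow> k < length (D ! i) \<Longrightarrow> D ! i ! k = Vertical s \<Longrightarrow>
    joined D (top_pt D i k 0) (bot_pt D i k 0)"
| cup: "i < length D \<Longrightarrow> k < length (D ! i) \<Longrightarrow> D ! i ! k = Cup s \<Longrightarrow>
    joined D (top_pt D i k 0) (top_pt D i k 1)"
| cap: "i < length D \<Longrightarrow> k < length (D ! i) \<Longrightarrow> D ! i ! k = Cap s \<Longrightarrow>
    joined D (bot_pt D i k 0) (bot_pt D i k 1)"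
| over_pos: "i < length D \<Longrightarrow> k < length (D ! i) \<Longrightarrow> D ! i ! k = X_pos \<Longrightarrow>
    joined D (top_pt D i k 1) (bot_pt D i k 0)"
| over_neg: "i < length D \<Longrightarrow> k < length (D ! i) \<Longrightarrow> D ! i ! k = X_neg \<Longrightarrow>
    joined D (top_pt D i k 0) (bot_pt D i k 1)"

text \<open>An arc is represented by the set of points through which it passes.\<close>

definition arc_of :: "diagram \<Rightarrow> point \<Rightarrow> point set" where
  "arc_of D p = {q \<in> points D. equivclp (joined D) p q}"

definition arcs :: "diagram \<Rightarrow> point set set" where
  "arcs D = arc_of D ` points D"

abbreviation top_arc :: "diagram \<Rightarrow> nat \<Rightarrow> nat \<Rightarrow> nat \<Rightarrow> point set" where
  "top_arc D i k a \<equiv> arc_of D (top_pt D i k a)"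

abbreviation bot_arc :: "diagram \<Rightarrow> nat \<Rightarrow> nat \<Rightarrow> nat \<Rightarrow> point set" where
  "bot_arc D i k a \<equiv> arc_of D (bot_pt D i k a)"

definition crossings :: "diagram \<Rightarrow> (nat \<times> nat) set" where
  "crossings D = {(i, k). i < length D \<and> k < length (D ! i) \<and> D ! i ! k \<in> {X_pos, X_neg}}"


section \<open>Rack colourings\<close>

definition rack_colourings ::
  "'a set \<Rightarrow> ('a \<Rightarrow> 'a \<Rightarrow> 'a) \<Rightarrow> ('a \<Rightarrow> 'a \<Rightarrow> 'a) \<Rightarrow> diagram \<Rightarrow> (point set \<Rightarrow> 'a) set" where
  "rack_colourings R rk lk D =
    {c \<in> arcs D \<rightarrow>\<^sub>E R. \<forall>(i, k) \<in> crossings D.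
       (D ! i ! k = X_pos \<longrightarrow>
          c (top_arc D i k 0) = rk (c (bot_arc D i k 0)) (c (bot_arc D i k 1))) \<and>
       (D ! i ! k = X_neg \<longrightarrow>
          c (top_arc D i k 1) = lk (c (bot_arc D i k 0)) (c (top_arc D i k 0)))}"

definition rack_invariant ::
  "'a set \<Rightarrow> ('a \<Rightarrow> 'a \<Rightarrow> 'a) \<Rightarrow> ('a \<Rightarrow> 'a \<Rightarrow> 'a) \<Rightarrow> diagram \<Rightarrow> nat" where
  "rack_invariant R rk lk D = card (rack_colourings R rk lk D)"


section \<open>Crossed modules and framed Reidemeister pairs\<close>

text \<open>
  \<^const>\<open>AutoGroup\<close> consists of automorphisms that are extensional, that is, \<^const>\<open>undefined\<close>
  outside the carrier.
\<close>

locale crossed_module =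
  boundary: group_hom P H \<mu> + action: group_hom H "AutoGroup P" act
  for P :: "('p, 'c) monoid_scheme" and H :: "('h, 'd) monoid_scheme"
    and \<mu> :: "'p \<Rightarrow> 'h" and act :: "'h \<Rightarrow> 'p \<Rightarrow> 'p" +
  assumes equivariance: "g \<in> carrier H \<Longrightarrow> e \<in> carrier P \<Longrightarrow>
      \<mu> (act g e) = g \<otimes>\<^bsub>H\<^esub> \<mu> e \<otimes>\<^bsub>H\<^esub> inv\<^bsub>H\<^esub> g"
    and peiffer: "e \<in> carrier P \<Longrightarrow> f \<in> carrier P \<Longrightarrow>
      act (\<mu> e) f = e \<otimes>\<^bsub>P\<^esub> f \<otimes>\<^bsub>P\<^esub> inv\<^bsub>P\<^esub> e"

definition conj_act :: "('a, 'b) monoid_scheme \<Rightarrow> 'a \<Rightarrow> 'a \<Rightarrow> 'a" where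
  "conj_act G g = (\<lambda>e \<in> carrier G. g \<otimes>\<^bsub>G\<^esub> e \<otimes>\<^bsub>G\<^esub> inv\<^bsub>G\<^esub> g)"

text \<open>
  The colour of the upper under arc, for over arc \<open>X\<close> and lower under arc \<open>Y\<close>, at a positive and
  at a negative crossing.
\<close>

definition under_pos :: "('h, 'd) monoid_scheme \<Rightarrow> ('p \<Rightarrow> 'h) \<Rightarrow> ('h \<Rightarrow> 'h \<Rightarrow> 'p) \<Rightarrow> 'h \<Rightarrow> 'h \<Rightarrow> 'h"
  where "under_pos H \<mu> \<psi> X Y = inv\<^bsub>H\<^esub> (\<mu> (\<psi> X Y)) \<otimes>\<^bsub>H\<^esub> X \<otimes>\<^bsub>H\<^esub> Y \<otimes>\<^bsub>H\<^esub> inv\<^bsub>H\<^esub> X"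

definition under_neg :: "('h, 'd) monoid_scheme \<Rightarrow> ('p \<Rightarrow> 'h) \<Rightarrow> ('h \<Rightarrow> 'h \<Rightarrow> 'p) \<Rightarrow> 'h \<Rightarrow> 'h \<Rightarrow> 'h"
  where "under_neg H \<mu> \<phi> X Y = inv\<^bsub>H\<^esub> X \<otimes>\<^bsub>H\<^esub> inv\<^bsub>H\<^esub> (\<mu> (\<phi> X Y)) \<otimes>\<^bsub>H\<^esub> Y \<otimes>\<^bsub>H\<^esub> X"

definition framed_Reidemeister_pair ::
  "('p, 'c) monoid_scheme \<Rightarrow> ('h, 'd) monoid_scheme \<Rightarrow> ('p \<Rightarrow> 'h) \<Rightarrow> ('h \<Rightarrow> 'p \<Rightarrow> 'p) \<Rightarrow>
   ('h \<Rightarrow> 'h \<Rightarrow> 'p) \<Rightarrow> ('h \<Rightarrow> 'h \<Rightarrow> 'p) \<Rightarrow> bool" where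
  "framed_Reidemeister_pair P H \<mu> act \<psi> \<phi> \<longleftrightarrow>
     \<psi> \<in> carrier H \<rightarrow> carrier H \<rightarrow> carrier P \<and>
     \<phi> \<in> carrier H \<rightarrow> carrier H \<rightarrow> carrier P \<and>
     (\<forall>X \<in> carrier H. \<forall>Y \<in> carrier H.
        \<phi> X Y \<otimes>\<^bsub>P\<^esub> \<psi> X (under_neg H \<mu> \<phi> X Y) = \<one>\<^bsub>P\<^esub>) \<and>
     (\<forall>X \<in> carrier H. \<forall>Y \<in> carrier H. \<forall>T \<in> carrier H.
        let Z = under_neg H \<mu> \<phi> Y X; V = under_neg H \<mu> \<phi> T Y; W = under_neg H \<mu> \<phi> T X in
        \<phi> Y X \<otimes>\<^bsub>P\<^esub> act Y (\<phi> T Z) \<otimes>\<^bsub>P\<^esub> \<phi> T Y =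
        act X (\<phi> T Y) \<otimes>\<^bsub>P\<^esub> \<phi> T X \<otimes>\<^bsub>P\<^esub> act T (\<phi> V W)) \<and>
     (\<forall>Z \<in> carrier H. \<exists>!A. A \<in> carrier H \<and> \<mu> (\<phi> A Z) \<otimes>\<^bsub>H\<^esub> A = Z) \<and>
     (let f = (\<lambda>Z. THE A. A \<in> carrier H \<and> \<mu> (\<phi> A Z) \<otimes>\<^bsub>H\<^esub> A = Z);
          g = (\<lambda>A. inv\<^bsub>H\<^esub> (\<mu> (\<psi> A A)) \<otimes>\<^bsub>H\<^esub> A)
      in (\<forall>A \<in> carrier H. f (g A) = A) \<and> (\<forall>Z \<in> carrier H. g (f Z) = Z))"


section \<open>Reidemeister colourings\<close>

text \<open>
  A Reidemeister colouring is a pair \<open>(c, d)\<close>, where \<open>c\<close> colours the arcs by elements of \<open>H\<close> and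
  \<open>d\<close> the crossings by elements of \<open>P\<close>.
\<close>

definition Reidemeister_colourings ::
  "('p, 'c) monoid_scheme \<Rightarrow> ('h, 'd) monoid_scheme \<Rightarrow> ('p \<Rightarrow> 'h) \<Rightarrow>
   ('h \<Rightarrow> 'h \<Rightarrow> 'p) \<Rightarrow> ('h \<Rightarrow> 'h \<Rightarrow> 'p) \<Rightarrow> diagram \<Rightarrow>
   ((point set \<Rightarrow> 'h) \<times> (nat \<times> nat \<Rightarrow> 'p)) set" where
  "Reidemeister_colourings P H \<mu> \<psi> \<phi> D =
    {(c, d) \<in> (arcs D \<rightarrow>\<^sub>E carrier H) \<times> (crossings D \<rightarrow>\<^sub>E carrier P). \<forall>(i, k) \<in> crossings D.
       (D ! i ! k = X_pos \<longrightarrow>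
          (let X = c (bot_arc D i k 0); Y = c (bot_arc D i k 1); Z = c (top_arc D i k 0)
           in d (i, k) = \<psi> X Y \<and> Z = under_pos H \<mu> \<psi> X Y)) \<and>
       (D ! i ! k = X_neg \<longrightarrow>
          (let X = c (top_arc D i k 0); Y = c (bot_arc D i k 0); Z = c (top_arc D i k 1)
           in d (i, k) = \<phi> X Y \<and> Z = under_neg H \<mu> \<phi> X Y))}"


section \<open>The monoidal category of a crossed module and the evaluation\<close>

text \<open>
  The triple \<open>(U, e, V)\<close> stands for the morphism from \<open>U\<close> to \<open>V\<close> with element \<open>e\<close>, where
  \<open>\<mu> e \<otimes>\<^bsub>H\<^esub> U = V\<close>. The operations below are total and do not check this equation or that
  composed morphisms match; both hold for the morphisms arising from Reidemeister colourings.
  Composition is in diagrammatic order.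
\<close>

type_synonym ('h, 'p) mor = "'h \<times> 'p \<times> 'h"

definition id_mor ::
  "('p, 'c) monoid_scheme \<Rightarrow> 'h \<Rightarrow> ('h, 'p) mor" where
  "id_mor P U = (U, \<one>\<^bsub>P\<^esub>, U)"

definition comp_mor ::
  "('p, 'c) monoid_scheme \<Rightarrow> ('h, 'p) mor \<Rightarrow> ('h, 'p) mor \<Rightarrow> ('h, 'p) mor" where
  "comp_mor P = (\<lambda>(U, e, V) (V', f, W). (U, f \<otimes>\<^bsub>P\<^esub> e, W))"

definition tensor_mor ::
  "('p, 'c) monoid_scheme \<Rightarrow> ('h, 'd) monoid_scheme \<Rightarrow> ('h \<Rightarrow> 'p \<Rightarrow> 'p) \<Rightarrow>
   ('h, 'p) mor \<Rightarrow> ('h, 'p) mor \<Rightarrow> ('h, 'p) mor" where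
  "tensor_mor P H act =
    (\<lambda>(U, e, V) (U', e', V'). (U \<otimes>\<^bsub>H\<^esub> U', act V e' \<otimes>\<^bsub>P\<^esub> e, V \<otimes>\<^bsub>H\<^esub> V'))"

fun strand_obj :: "('h, 'd) monoid_scheme \<Rightarrow> orientation \<Rightarrow> 'h \<Rightarrow> 'h" where
  "strand_obj H Down X = X"
| "strand_obj H Up X = inv\<^bsub>H\<^esub> X"

definition piece_mor ::
  "('p, 'c) monoid_scheme \<Rightarrow> ('h, 'd) monoid_scheme \<Rightarrow> diagram \<Rightarrow>
   (point set \<Rightarrow> 'h) \<times> (nat \<times> nat \<Rightarrow> 'p) \<Rightarrow> nat \<Rightarrow> nat \<Rightarrow> ('h, 'p) mor" where
  "piece_mor P H D F i k =
    (let c = fst F; d = snd F;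
         t = (\<lambda>a. c (top_arc D i k a));
         b = (\<lambda>a. c (bot_arc D i k a))
     in case D ! i ! k of
          Vertical s \<Rightarrow> id_mor P (strand_obj H s (t 0))
        | Cup s \<Rightarrow>
            (strand_obj H s (t 0) \<otimes>\<^bsub>H\<^esub> strand_obj H (opposite s) (t 1), \<one>\<^bsub>P\<^esub>, \<one>\<^bsub>H\<^esub>)
        | Cap s \<Rightarrow>
            (\<one>\<^bsub>H\<^esub>, \<one>\<^bsub>P\<^esub>, strand_obj H s (b 0) \<otimes>\<^bsub>H\<^esub> strand_obj H (opposite s) (b 1))
        | X_pos \<Rightarrow> (t 0 \<otimes>\<^bsub>H\<^esub> t 1, d (i, k), b 0 \<otimes>\<^bsub>H\<^esub> b 1)
        | X_neg \<Rightarrow> (t 0 \<otimes>\<^bsub>H\<^esub> t 1, d (i, k), b 0 \<otimes>\<^bsub>H\<^esub> b 1))"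

text \<open>The identity of the unit object is the empty tensor product and the empty composite.\<close>

definition strip_mor ::
  "('p, 'c) monoid_scheme \<Rightarrow> ('h, 'd) monoid_scheme \<Rightarrow> ('h \<Rightarrow> 'p \<Rightarrow> 'p) \<Rightarrow> diagram \<Rightarrow>
   (point set \<Rightarrow> 'h) \<times> (nat \<times> nat \<Rightarrow> 'p) \<Rightarrow> nat \<Rightarrow> ('h, 'p) mor" where
  "strip_mor P H act D F i =
    foldr (tensor_mor P H act) (map (piece_mor P H D F i) [0..<length (D ! i)]) (id_mor P \<one>\<^bsub>H\<^esub>)"

definition diagram_mor ::
  "('p, 'c) monoid_scheme \<Rightarrow> ('h, 'd) monoid_scheme \<Rightarrow> ('h \<Rightarrow> 'p \<Rightarrow> 'p) \<Rightarrow> diagram \<Rightarrow>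
   (point set \<Rightarrow> 'h) \<times> (nat \<times> nat \<Rightarrow> 'p) \<Rightarrow> ('h, 'p) mor" where
  "diagram_mor P H act D F =
    foldr (comp_mor P) (map (strip_mor P H act D F) [0..<length D]) (id_mor P \<one>\<^bsub>H\<^esub>)"

definition evaluation ::
  "('p, 'c) monoid_scheme \<Rightarrow> ('h, 'd) monoid_scheme \<Rightarrow> ('h \<Rightarrow> 'p \<Rightarrow> 'p) \<Rightarrow> diagram \<Rightarrow>
   (point set \<Rightarrow> 'h) \<times> (nat \<times> nat \<Rightarrow> 'p) \<Rightarrow> 'p" where
  "evaluation P H act D F = (case diagram_mor P H act D F of (U, e, V) \<Rightarrow> e)"

text \<open>
  The additive group of the integral group ring of the kernel of \<open>\<mu>\<close> is
  \<^term>\<open>free_Abelian_group (kernel P H \<mu>)\<close>; \<^term>\<open>frag_of e\<close> is the basis element of \<open>e\<close>.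
\<close>

definition Reidemeister_invariant ::
  "('p, 'c) monoid_scheme \<Rightarrow> ('h, 'd) monoid_scheme \<Rightarrow> ('p \<Rightarrow> 'h) \<Rightarrow> ('h \<Rightarrow> 'p \<Rightarrow> 'p) \<Rightarrow>
   ('h \<Rightarrow> 'h \<Rightarrow> 'p) \<Rightarrow> ('h \<Rightarrow> 'h \<Rightarrow> 'p) \<Rightarrow> diagram \<Rightarrow> 'p \<Rightarrow>\<^sub>0 int" where
  "Reidemeister_invariant P H \<mu> act \<psi> \<phi> D =
    (\<Sum>F \<in> Reidemeister_colourings P H \<mu> \<psi> \<phi> D. frag_of (evaluation P H act D F))"


section \<open>The pair obtained from a rack and a group structure on its underlying set\<close>

definition rack_\<psi> :: "('a, 'b) monoid_scheme \<Rightarrow> ('a \<Rightarrow> 'a \<Rightarrow> 'a) \<Rightarrow> 'a \<Rightarrow> 'a \<Rightarrow> 'a" where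
  "rack_\<psi> G rk B A = B \<otimes>\<^bsub>G\<^esub> A \<otimes>\<^bsub>G\<^esub> inv\<^bsub>G\<^esub> B \<otimes>\<^bsub>G\<^esub> inv\<^bsub>G\<^esub> (rk B A)"

definition rack_\<phi> :: "('a, 'b) monoid_scheme \<Rightarrow> ('a \<Rightarrow> 'a \<Rightarrow> 'a) \<Rightarrow> 'a \<Rightarrow> 'a \<Rightarrow> 'a" where
  "rack_\<phi> G lk B A = A \<otimes>\<^bsub>G\<^esub> B \<otimes>\<^bsub>G\<^esub> inv\<^bsub>G\<^esub> (lk A B) \<otimes>\<^bsub>G\<^esub> inv\<^bsub>G\<^esub> B"

end

theory Submission
  imports Defs
begin

text \<open>
  With \<open>\<mu> = id\<close> the relation \<open>\<mu>(e) U = V\<close> defining a morphism \<open>U \<rightarrow> V\<close> determines \<open>e\<close>, so the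
  evaluation of every Reidemeister colouring, a morphism \<open>1 \<rightarrow> 1\<close>, is trivial. The defining
  equations of \<open>\<psi>\<close> and \<open>\<phi>\<close> are solved exactly so that the Reidemeister colouring conditions at a
  crossing become the rack colouring conditions; hence \<open>I\<^sub>\<Phi>(D)\<close> just counts rack colourings.
  For the comparison of invariants, a nonempty finite rack is transported to \<open>{..<n}\<close> with the
  group structure of the integers modulo \<open>n\<close>. The empty rack carries no group structure, but it only
  detects whether a diagram has an arc, which the trivial rack with two elements also detects.
\<close>

section \<open>Link diagrams\<close>

text \<open>The edge below the last strip is empty by convention, so in a link diagram strip
  \<open>i\<close> always runs from \<open>edge D i\<close> to \<open>edge D (Suc i)\<close>, the
  last strip included.\<close>

definition edge :: "diagram \<Rightarrow> nat \<Rightarrow> orientation list" where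
  "edge D i = (if i < length D then strip_top (D ! i) else [])"

lemma points_edge: "(i, j) \<in> points D \<longleftrightarrow> j < length (edge D i)"
  by (auto simp: points_def edge_def)

lemma edge_0: "link_diagram D \<Longrightarrow> edge D 0 = []"
  by (cases D) (auto simp: link_diagram_def edge_def)

lemma strip_bottom_edge:
  assumes "link_diagram D" "i < length D"
  shows "strip_bottom (D ! i) = edge D (Suc i)"
proof (cases "Suc i < length D")
  case True
  then show ?thesis using assms by (simp add: link_diagram_def edge_def)
next
  case False
  with assms(2) have "i = length D - 1" "D \<noteq> []" by auto
  then have "D ! i = last D" by (simp add: last_conv_nth)
  then show ?thesis using assms False \<open>D \<noteq> []\<close> by (simp add: link_diagram_def edge_def)
qed

text \<open>Applied with \<open>top_ends\<close> or \<open>bottom_ends\<close> for \<open>f\<close>: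
  the offset by which \<open>top_pt\<close> and \<open>bot_pt\<close> locate an end of piece
  \<open>k\<close> stays within its edge.\<close>

lemma length_concat_map_take:
  assumes "k < length s" "a < length (f (s ! k))"
  shows "length (concat (map f (take k s))) + a < length (concat (map f s))"
proof -
  have "concat (map f s) = concat (map f (take k s)) @ f (s ! k) @ concat (map f (drop (Suc k) s))"
    using id_take_nth_drop[OF assms(1)]
    by (metis concat.simps(2) concat_append list.simps(9) map_append)
  then show ?thesis using assms(2) by simp
qed

lemma top_pt_in_points:
  assumes "i < length D" "k < length (D ! i)" "a < length (top_ends (D ! i ! k))"
  shows "top_pt D i k a \<in> points D"
  using length_concat_map_take[of k "D ! i" a top_ends] assms
  by (simp add: points_edge edge_def top_pt_def strip_top_def)

text \<open>Bottom ends lie on the top edge of the next strip. The last strip of a link diagram has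
  no bottom ends, so no point outside \<open>points D\<close> arises there.\<close>

lemma bot_pt_in_points:
  assumes "link_diagram D" "i < length D" "k < length (D ! i)"
    "a < length (bottom_ends (D ! i ! k))"
  shows "bot_pt D i k a \<in> points D"
  using length_concat_map_take[of k "D ! i" a bottom_ends] assms
    strip_bottom_edge[of D i]
  by (simp add: points_edge bot_pt_def flip: strip_bottom_def)

lemma top_arc_in_arcs:
  "i < length D \<Longrightarrow> k < length (D ! i) \<Longrightarrow> a < length (top_ends (D ! i ! k)) \<Longrightarrow>
    top_arc D i k a \<in> arcs D"
  by (simp add: arcs_def top_pt_in_points)

lemma bot_arc_in_arcs:
  "link_diagram D \<Longrightarrow> i < length D \<Longrightarrow> k < length (D ! i) \<Longrightarrow>
    a < length (bottom_ends (D ! i ! k)) \<Longrightarrow> bot_arc D i k a \<in> arcs D"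
  by (simp add: arcs_def bot_pt_in_points)

lemma joined_arc_of: "joined D p q \<Longrightarrow> arc_of D p = arc_of D q"
  unfolding arc_of_def
  by (metis equivclp_sym equivclp_trans r_into_equivclp)

lemma crossingsE:
  assumes "(i, k) \<in> crossings D"
  obtains "D ! i ! k = X_pos" "i < length D" "k < length (D ! i)"
    | "D ! i ! k = X_neg" "i < length D" "k < length (D ! i)"
  using assms by (auto simp: crossings_def)

lemma crossing_arcs:
  assumes "link_diagram D" "(i, k) \<in> crossings D" "a < 2"
  shows "top_arc D i k a \<in> arcs D" "bot_arc D i k a \<in> arcs D"
  using assms by (auto elim!: crossingsE intro!: top_arc_in_arcs bot_arc_in_arcs)

lemma over_arc_pos: "(i, k) \<in> crossings D \<Longrightarrow> D ! i ! k = X_pos \<Longrightarrow> top_arc D i k 1 = bot_arc D i k 0"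
  by (intro joined_arc_of joined.over_pos) (auto simp: crossings_def)

lemma over_arc_neg: "(i, k) \<in> crossings D \<Longrightarrow> D ! i ! k = X_neg \<Longrightarrow> top_arc D i k 0 = bot_arc D i k 1"
  by (intro joined_arc_of joined.over_neg) (auto simp: crossings_def)


section \<open>Morphisms of the category of a crossed module\<close>

text \<open>Restores the typing that the total operations on triples do not check.\<close>

definition hom_set ::
  "('p, 'c) monoid_scheme \<Rightarrow> ('h, 'd) monoid_scheme \<Rightarrow> ('p \<Rightarrow> 'h) \<Rightarrow> 'h \<Rightarrow> 'h \<Rightarrow> ('h, 'p) mor set" where
  "hom_set P H \<mu> U V = {(U, e, V) | e. e \<in> carrier P \<and> \<mu> e \<otimes>\<^bsub>H\<^esub> U = V}"

text \<open>
  The object of a sequence of oriented points on a horizontal line; \<open>t j\<close> is the colour of the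
  \<open>j\<close>-th point of the line and \<open>n\<close> the position of the first point of the sequence.
\<close>

primrec word_obj ::
  "('h, 'd) monoid_scheme \<Rightarrow> (nat \<Rightarrow> 'h) \<Rightarrow> nat \<Rightarrow> orientation list \<Rightarrow> 'h" where
  "word_obj H t n [] = \<one>\<^bsub>H\<^esub>"
| "word_obj H t n (s # ss) = strand_obj H s (t n) \<otimes>\<^bsub>H\<^esub> word_obj H t (Suc n) ss"

context group
begin

lemma inv_mult_cancel_left: "x \<in> carrier G \<Longrightarrow> y \<in> carrier G \<Longrightarrow> inv x \<otimes> (x \<otimes> y) = y"
  by (simp flip: m_assoc)

lemma mult_inv_cancel_left: "x \<in> carrier G \<Longrightarrow> y \<in> carrier G \<Longrightarrow> x \<otimes> (inv x \<otimes> y) = y"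
  by (simp flip: m_assoc)

lemmas group_word_simps = m_assoc inv_mult_group inv_mult_cancel_left mult_inv_cancel_left

lemma strand_obj_closed: "x \<in> carrier G \<Longrightarrow> strand_obj G s x \<in> carrier G"
  by (cases s) simp_all

lemma strand_obj_opposite:
  "x \<in> carrier G \<Longrightarrow> strand_obj G s x \<otimes> strand_obj G (opposite s) x = \<one>"
  by (cases s) simp_all

text \<open>Colours are known to be group elements only at existing points, hence the restriction of
  \<open>j\<close> to the positions of the word.\<close>

lemma word_obj_closed:
  "\<forall>j. n \<le> j \<and> j < n + length ss \<longrightarrow> t j \<in> carrier G \<Longrightarrow> word_obj G t n ss \<in> carrier G"
  by (induction ss arbitrary: n) (auto intro!: m_closed strand_obj_closed)

lemma word_obj_append:
  "\<forall>j. n \<le> j \<and> j < n + length ss + length ss' \<longrightarrow> t j \<in> carrier G \<Longrightarrow>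
    word_obj G t n (ss @ ss') = word_obj G t n ss \<otimes> word_obj G t (n + length ss) ss'"
proof (induction ss arbitrary: n)
  case Nil
  then show ?case by (simp add: word_obj_closed)
next
  case (Cons s ss)
  have "word_obj G t (Suc n) ss \<in> carrier G"
    "word_obj G t (Suc (n + length ss)) ss' \<in> carrier G" "t n \<in> carrier G"
    using Cons.prems by (auto intro!: word_obj_closed)
  then show ?case using Cons by (simp add: strand_obj_closed m_assoc)
qed

end

context crossed_module
begin

lemma act_closed: "g \<in> carrier H \<Longrightarrow> e \<in> carrier P \<Longrightarrow> act g e \<in> carrier P"
  using action.hom_closed[of g] by (auto simp: AutoGroup_def auto_def hom_def)

lemma id_mor_in_hom_set: "U \<in> carrier H \<Longrightarrow> id_mor P U \<in> hom_set P H \<mu> U U"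
  by (simp add: id_mor_def hom_set_def)

lemma comp_mor_in_hom_set:
  assumes "m \<in> hom_set P H \<mu> U V" "m' \<in> hom_set P H \<mu> V W" "U \<in> carrier H"
  shows "comp_mor P m m' \<in> hom_set P H \<mu> U W"
  using assms by (auto simp: hom_set_def comp_mor_def boundary.H.m_assoc)

text \<open>Equivariance turns \<open>\<mu> (act V e')\<close> into the conjugate of
  \<open>\<mu> e'\<close> by \<open>V\<close>; the trailing inverse of \<open>V\<close> cancels
  against \<open>V\<close>, which is the product of \<open>\<mu> e\<close> and
  \<open>U\<close>.\<close>

lemma tensor_mor_in_hom_set:
  assumes "m \<in> hom_set P H \<mu> U V" "m' \<in> hom_set P H \<mu> U' V'" "U \<in> carrier H" "U' \<in> carrier H"
  shows "tensor_mor P H act m m' \<in> hom_set P H \<mu> (U \<otimes>\<^bsub>H\<^esub> U') (V \<otimes>\<^bsub>H\<^esub> V')"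
proof -
  from assms(1) obtain e where e: "e \<in> carrier P" "V = \<mu> e \<otimes>\<^bsub>H\<^esub> U" "m = (U, e, V)"
    by (auto simp: hom_set_def)
  from assms(2) obtain e' where e': "e' \<in> carrier P" "V' = \<mu> e' \<otimes>\<^bsub>H\<^esub> U'" "m' = (U', e', V')"
    by (auto simp: hom_set_def)
  have V: "V \<in> carrier H" using e assms by simp
  have "\<mu> (act V e' \<otimes>\<^bsub>P\<^esub> e) \<otimes>\<^bsub>H\<^esub> (U \<otimes>\<^bsub>H\<^esub> U') = \<mu> (act V e') \<otimes>\<^bsub>H\<^esub> (\<mu> e \<otimes>\<^bsub>H\<^esub> U) \<otimes>\<^bsub>H\<^esub> U'"
    using e(1) e'(1) V assms(3,4) act_closed[of V e'] by (simp add: boundary.H.m_assoc)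
  also have "\<dots> = V \<otimes>\<^bsub>H\<^esub> \<mu> e' \<otimes>\<^bsub>H\<^esub> inv\<^bsub>H\<^esub> V \<otimes>\<^bsub>H\<^esub> V \<otimes>\<^bsub>H\<^esub> U'"
    using equivariance[OF V e'(1)] by (simp only: e(2)[symmetric])
  also have "\<dots> = V \<otimes>\<^bsub>H\<^esub> V'"
    using V e'(1) assms(4) by (simp add: e'(2) boundary.H.group_word_simps)
  finally show ?thesis
    using e e' V by (simp add: hom_set_def tensor_mor_def act_closed)
qed

end


section \<open>Evaluation of Reidemeister colourings\<close>

locale coloured_diagram = crossed_module +
  fixes \<psi> \<phi> D c d
  assumes link: "link_diagram D"
    and colouring: "(c, d) \<in> Reidemeister_colourings P H \<mu> \<psi> \<phi> D"
begin

definition colour where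
  "colour i j = c (arc_of D (i, j))"

lemma colour_closed: "j < length (edge D i) \<Longrightarrow> colour i j \<in> carrier H"
  using colouring
  by (auto simp: Reidemeister_colourings_def colour_def arcs_def PiE_def simp flip: points_edge)

abbreviation top_pos :: "nat \<Rightarrow> nat \<Rightarrow> nat" where
  "top_pos i k \<equiv> length (strip_top (take k (D ! i)))"

abbreviation bot_pos :: "nat \<Rightarrow> nat \<Rightarrow> nat" where
  "bot_pos i k \<equiv> length (strip_bottom (take k (D ! i)))"

lemma colour_top:
  assumes "i < length D" "k < length (D ! i)" "a < length (top_ends (D ! i ! k))"
  shows "c (top_arc D i k a) \<in> carrier H"
  using colouring top_arc_in_arcs[OF assms]
  by (auto simp: Reidemeister_colourings_def PiE_def)

lemma colour_bot:
  assumes "i < length D" "k < length (D ! i)" "a < length (bottom_ends (D ! i ! k))"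
  shows "c (bot_arc D i k a) \<in> carrier H"
  using colouring bot_arc_in_arcs[OF link assms]
  by (auto simp: Reidemeister_colourings_def PiE_def)

lemma crossing_pos:
  assumes "(i, k) \<in> crossings D" "D ! i ! k = X_pos"
  shows "d (i, k) \<in> carrier P"
    "c (top_arc D i k 0) = inv\<^bsub>H\<^esub> (\<mu> (d (i, k))) \<otimes>\<^bsub>H\<^esub> c (bot_arc D i k 0) \<otimes>\<^bsub>H\<^esub>
      c (bot_arc D i k 1) \<otimes>\<^bsub>H\<^esub> inv\<^bsub>H\<^esub> (c (bot_arc D i k 0))"
  using colouring assms
  by (auto simp: Reidemeister_colourings_def under_pos_def Let_def PiE_def Pi_def)

lemma crossing_neg:
  assumes "(i, k) \<in> crossings D" "D ! i ! k = X_neg"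
  shows "d (i, k) \<in> carrier P"
    "c (top_arc D i k 1) = inv\<^bsub>H\<^esub> (c (top_arc D i k 0)) \<otimes>\<^bsub>H\<^esub> inv\<^bsub>H\<^esub> (\<mu> (d (i, k))) \<otimes>\<^bsub>H\<^esub>
      c (bot_arc D i k 0) \<otimes>\<^bsub>H\<^esub> c (top_arc D i k 0)"
  using colouring assms
  by (auto simp: Reidemeister_colourings_def under_neg_def Let_def PiE_def Pi_def)

text \<open>Joined ends lie on one arc and share a colour, so vertical strands give identities, and
  the two ends of a cup or cap contribute inverse factors. At a crossing the over strand has the
  same colour above and below, and the condition on the upper under arc, solved for the product of
  the bottom colours, is the equation \<open>\<mu> e \<otimes> U = V\<close>.\<close>

lemma piece_mor_in_hom_set:
  assumes i: "i < length D" and k: "k < length (D ! i)"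
  shows "piece_mor P H D (c, d) i k \<in> hom_set P H \<mu>
    (word_obj H (colour i) (top_pos i k) (top_ends (D ! i ! k)))
    (word_obj H (colour (Suc i)) (bot_pos i k) (bottom_ends (D ! i ! k)))"
proof -
  have top: "colour i (top_pos i k) = c (top_arc D i k 0)"
    "colour i (Suc (top_pos i k)) = c (top_arc D i k 1)"
    and bot: "colour (Suc i) (bot_pos i k) = c (bot_arc D i k 0)"
    "colour (Suc i) (Suc (bot_pos i k)) = c (bot_arc D i k 1)"
    by (simp_all add: colour_def top_pt_def bot_pt_def)
  note ct = colour_top[OF i k] and cb = colour_bot[OF i k]
  show ?thesis
  proof (cases "D ! i ! k")
    case (Vertical s)
    then have "top_arc D i k 0 = bot_arc D i k 0"
      using i k by (intro joined_arc_of joined.vertical)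
    then show ?thesis
      using Vertical ct[of 0] top bot
      by (simp add: piece_mor_def id_mor_in_hom_set boundary.H.strand_obj_closed)
  next
    case (Cup s)
    then have "top_arc D i k 0 = top_arc D i k 1"
      using i k by (intro joined_arc_of joined.cup)
    then show ?thesis
      using Cup ct[of 0] top
      by (simp add: piece_mor_def hom_set_def boundary.H.strand_obj_opposite
          boundary.H.strand_obj_closed)
  next
    case (Cap s)
    then have "bot_arc D i k 0 = bot_arc D i k 1"
      using i k by (intro joined_arc_of joined.cap)
    then show ?thesis
      using Cap cb[of 0] bot
      by (simp add: piece_mor_def hom_set_def boundary.H.strand_obj_opposite
          boundary.H.strand_obj_closed)
  next
    case X_pos
    then have x: "(i, k) \<in> crossings D" using i k by (simp add: crossings_def)
    show ?thesis
      using X_pos crossing_pos[OF x X_pos] over_arc_pos[OF x X_pos] cb[of 0] cb[of 1] top bot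
      by (simp add: piece_mor_def hom_set_def boundary.H.group_word_simps)
  next
    case X_neg
    then have x: "(i, k) \<in> crossings D" using i k by (simp add: crossings_def)
    show ?thesis
      using X_neg crossing_neg[OF x X_neg] over_arc_neg[OF x X_neg] cb[of 0] cb[of 1] top bot
      by (simp add: piece_mor_def hom_set_def boundary.H.group_word_simps)
  qed
qed

lemma strip_mor_in_hom_set:
  assumes i: "i < length D"
  shows "strip_mor P H act D (c, d) i \<in> hom_set P H \<mu>
    (word_obj H (colour i) 0 (edge D i)) (word_obj H (colour (Suc i)) 0 (edge D (Suc i)))"
proof -
  let ?s = "D ! i"
  have top: "colour i j \<in> carrier H" if "j < length (strip_top ?s)" for j
    using that i by (intro colour_closed) (simp add: edge_def)
  have bot: "colour (Suc i) j \<in> carrier H" if "j < length (strip_bottom ?s)" for j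
    using that i by (intro colour_closed) (simp add: strip_bottom_edge[OF link])
  \<comment> \<open>Generalised to the pieces from \<open>k\<close> on, which are the suffixes that
    \<open>foldr\<close> evaluates; the words on both edges then start at the offsets
    \<open>top_pos i k\<close> and \<open>bot_pos i k\<close>.\<close>
  have "foldr (tensor_mor P H act) (map (piece_mor P H D (c, d) i) [k..<length ?s]) (id_mor P \<one>\<^bsub>H\<^esub>)
    \<in> hom_set P H \<mu> (word_obj H (colour i) (top_pos i k) (strip_top (drop k ?s)))
      (word_obj H (colour (Suc i)) (bot_pos i k) (strip_bottom (drop k ?s)))"
    if "k \<le> length ?s" for k
    using that
  proof (induction k rule: inc_induct)
    case base
    then show ?case by (simp add: strip_top_def strip_bottom_def id_mor_in_hom_set)
  next
    case (step k)
    then have k: "k < length ?s" by simp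
    have drop: "drop k ?s = ?s ! k # drop (Suc k) ?s"
      and take: "take (Suc k) ?s = take k ?s @ [?s ! k]"
      using k by (simp_all add: Cons_nth_drop_Suc take_Suc_conv_app_nth)
    have t: "strip_top (drop k ?s) = top_ends (?s ! k) @ strip_top (drop (Suc k) ?s)"
      "top_pos i (Suc k) = top_pos i k + length (top_ends (?s ! k))"
      and b: "strip_bottom (drop k ?s) = bottom_ends (?s ! k) @ strip_bottom (drop (Suc k) ?s)"
      "bot_pos i (Suc k) = bot_pos i k + length (bottom_ends (?s ! k))"
      by (simp_all add: drop take strip_top_def strip_bottom_def)
    have s: "strip_top ?s = strip_top (take k ?s) @ strip_top (drop k ?s)"
      "strip_bottom ?s = strip_bottom (take k ?s) @ strip_bottom (drop k ?s)"
      unfolding strip_top_def strip_bottom_def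
      by (metis append_take_drop_id concat_append map_append)+
    have len: "length (strip_top ?s) =
        top_pos i k + length (top_ends (?s ! k)) + length (strip_top (drop (Suc k) ?s))"
      "length (strip_bottom ?s) =
        bot_pos i k + length (bottom_ends (?s ! k)) + length (strip_bottom (drop (Suc k) ?s))"
      by (simp_all add: s t b)
    have closed: "word_obj H (colour i) (top_pos i k) (top_ends (?s ! k)) \<in> carrier H"
      "word_obj H (colour i) (top_pos i (Suc k)) (strip_top (drop (Suc k) ?s)) \<in> carrier H"
      using len top by (auto intro!: boundary.H.word_obj_closed simp: t)
    have "word_obj H (colour i) (top_pos i k) (strip_top (drop k ?s)) =
      word_obj H (colour i) (top_pos i k) (top_ends (?s ! k)) \<otimes>\<^bsub>H\<^esub>
      word_obj H (colour i) (top_pos i (Suc k)) (strip_top (drop (Suc k) ?s))"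
      \<comment> \<open>The lengths in \<open>len\<close> keep every position of both words inside
        the edge, where the colours are group elements.\<close>
      using len top unfolding t by (intro boundary.H.word_obj_append) auto
    moreover have "word_obj H (colour (Suc i)) (bot_pos i k) (strip_bottom (drop k ?s)) =
      word_obj H (colour (Suc i)) (bot_pos i k) (bottom_ends (?s ! k)) \<otimes>\<^bsub>H\<^esub>
      word_obj H (colour (Suc i)) (bot_pos i (Suc k)) (strip_bottom (drop (Suc k) ?s))"
      using len bot unfolding b by (intro boundary.H.word_obj_append) auto
    ultimately show ?case
      using tensor_mor_in_hom_set[OF piece_mor_in_hom_set[OF i k] step.IH closed] k
      by (simp add: upt_conv_Cons)
  qed
  from this[of 0] show ?thesis
    using i strip_bottom_edge[OF link i]
    by (simp add: strip_mor_def edge_def strip_top_def strip_bottom_def)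
qed

text \<open>Consecutive strips compose because they share the word of their common edge; the
  outermost edges are empty, and the empty word is the unit object.\<close>

lemma diagram_mor_in_hom_set: "diagram_mor P H act D (c, d) \<in> hom_set P H \<mu> \<one>\<^bsub>H\<^esub> \<one>\<^bsub>H\<^esub>"
proof -
  have "foldr (comp_mor P) (map (strip_mor P H act D (c, d)) [i..<length D]) (id_mor P \<one>\<^bsub>H\<^esub>)
    \<in> hom_set P H \<mu> (word_obj H (colour i) 0 (edge D i)) \<one>\<^bsub>H\<^esub>"
    if "i \<le> length D" for i
    using that
  proof (induction i rule: inc_induct)
    case base
    then show ?case by (simp add: edge_def id_mor_in_hom_set)
  next
    case (step i)
    have "word_obj H (colour i) 0 (edge D i) \<in> carrier H"
      by (intro boundary.H.word_obj_closed) (simp add: colour_closed)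
    then show ?case
      using comp_mor_in_hom_set[OF strip_mor_in_hom_set step.IH] step
      by (simp add: upt_conv_Cons)
  qed
  from this[of 0] show ?thesis by (simp add: diagram_mor_def edge_0[OF link])
qed

text \<open>An endomorphism of the unit object with element \<open>e\<close> satisfies
  \<open>\<mu> e \<otimes> \<one> = \<one>\<close>.\<close>

theorem evaluation_in_kernel: "evaluation P H act D (c, d) \<in> kernel P H \<mu>"
  using diagram_mor_in_hom_set by (auto simp: evaluation_def hom_set_def kernel_def)

end


section \<open>Racks\<close>

context rack
begin

text \<open>Distribute \<triangleleft> over \<open>(x \<triangleright> y) \<triangleleft> x\<close>,
  which is \<open>y\<close>. The lemma after this one is the mirror image.\<close>

lemma lk_lk_self:
  assumes "x \<in> R" "y \<in> R"
  shows "y \<triangleleft> (x \<triangleleft> x) = y \<triangleleft> x"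
  using lk_distrib[of "x \<triangleright> y" x x] assms by (simp add: rk_closed lk_rk)

lemma rk_rk_self:
  assumes "x \<in> R" "y \<in> R"
  shows "(x \<triangleright> x) \<triangleright> y = x \<triangleright> y"
  using rk_distrib[of x x "y \<triangleleft> x"] assms by (simp add: lk_closed rk_lk)

text \<open>With the next lemma: \<open>x \<triangleleft> x\<close> and
  \<open>x \<triangleright> x\<close> define mutually inverse maps. They turn out to be the maps
  \<open>f\<close> and \<open>g\<close> of the framing condition.\<close>

lemma lk_self_rk_self:
  assumes "x \<in> R"
  shows "(x \<triangleleft> x) \<triangleright> (x \<triangleleft> x) = x"
  using rk_lk[of "x \<triangleleft> x" x] lk_lk_self[of x x] assms by (simp add: lk_closed)

lemma rk_self_lk_self:
  assumes "x \<in> R"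
  shows "(x \<triangleright> x) \<triangleleft> (x \<triangleright> x) = x"
  using lk_rk[of "x \<triangleright> x" x] rk_rk_self[of x x] assms by (simp add: rk_closed)

text \<open>The equation defining \<open>f\<close> reduces to
  \<open>z \<triangleleft> x = x\<close>, so this gives existence and uniqueness of its solution.
  Forward, acting by \<open>x\<close> from the left yields \<open>z = x \<triangleright> x\<close>,
  and squaring is then undone.\<close>

lemma self_eq_lk_iff:
  assumes "x \<in> R" "z \<in> R"
  shows "z \<triangleleft> x = x \<longleftrightarrow> x = z \<triangleleft> z"
proof
  assume "z \<triangleleft> x = x"
  then have "x \<triangleright> x = z" using rk_lk[of x z] assms by simp
  then show "x = z \<triangleleft> z" using rk_self_lk_self assms by metis
next
  assume "x = z \<triangleleft> z"
  then show "z \<triangleleft> x = x" using lk_lk_self assms by simp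
qed

end

locale rack_group = rack R rk lk + group G
  for R :: "'a set" and rk lk and G :: "('a, 'b) monoid_scheme" (structure) +
  assumes carrier_eq: "carrier G = R"
begin

lemma rk_in_carrier: "x \<in> carrier G \<Longrightarrow> y \<in> carrier G \<Longrightarrow> rk x y \<in> carrier G"
  and lk_in_carrier: "x \<in> carrier G \<Longrightarrow> y \<in> carrier G \<Longrightarrow> lk x y \<in> carrier G"
  using rk_closed lk_closed by (simp_all add: carrier_eq)

lemma rack_\<psi>_closed: "x \<in> carrier G \<Longrightarrow> y \<in> carrier G \<Longrightarrow> rack_\<psi> G rk x y \<in> carrier G"
  by (simp add: rack_\<psi>_def rk_in_carrier)

lemma rack_\<phi>_closed: "x \<in> carrier G \<Longrightarrow> y \<in> carrier G \<Longrightarrow> rack_\<phi> G lk x y \<in> carrier G"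
  by (simp add: rack_\<phi>_def lk_in_carrier)

text \<open>\<open>rack_\<psi>\<close> is the conjugate of the lower under colour divided by the
  rack product, so dividing the conjugate by it leaves the rack product. \<open>rack_\<phi>\<close>
  solves the negative crossing likewise.\<close>

lemma under_pos_rack_\<psi>:
  "x \<in> carrier G \<Longrightarrow> y \<in> carrier G \<Longrightarrow> under_pos G id (rack_\<psi> G rk) x y = rk x y"
  by (simp add: under_pos_def rack_\<psi>_def rk_in_carrier group_word_simps)

lemma under_neg_rack_\<phi>:
  "x \<in> carrier G \<Longrightarrow> y \<in> carrier G \<Longrightarrow> under_neg G id (rack_\<phi> G lk) x y = lk y x"
  by (simp add: under_neg_def rack_\<phi>_def lk_in_carrier group_word_simps)

end


section \<open>The crossed module of a group acting on itself by conjugation\<close>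

context group
begin

text \<open>Conjugation by \<open>inv g\<close> is the inverse bijection; the restriction in
  \<open>conj_act\<close> supplies the extensionality that \<open>Bij\<close> demands.\<close>

lemma conj_act_in_auto:
  assumes g: "g \<in> carrier G"
  shows "conj_act G g \<in> auto G"
proof -
  have "bij_betw (conj_act G g) (carrier G) (carrier G)"
    using g by (intro bij_betw_byWitness[where f' = "conj_act G (inv g)"])
      (auto simp: conj_act_def group_word_simps)
  then show ?thesis
    using g by (auto simp: auto_def Bij_def hom_def conj_act_def group_word_simps)
qed

lemma crossed_module_conj: "crossed_module G G id (conj_act G)"
proof -
  interpret AG: group "AutoGroup G" by (rule AutoGroup)
  have "conj_act G (x \<otimes> y) = conj_act G x \<otimes>\<^bsub>AutoGroup G\<^esub> conj_act G y"
    if "x \<in> carrier G" "y \<in> carrier G" for x y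
    using that conj_act_in_auto[of x] conj_act_in_auto[of y]
    by (auto simp: AutoGroup_def BijGroup_def auto_def compose_def conj_act_def fun_eq_iff
        group_word_simps)
  then have "conj_act G \<in> hom G (AutoGroup G)"
    by (auto simp: hom_def conj_act_in_auto AutoGroup_def)
  then show ?thesis
    by unfold_locales (auto simp: hom_def conj_act_def)
qed

end

section \<open>The framed Reidemeister conditions for the rack pair\<close>

context rack_group
begin

lemma framed_Reidemeister_pair_rack:
  "framed_Reidemeister_pair G G id (conj_act G) (rack_\<psi> G rk) (rack_\<phi> G lk)"
proof -
  \<comment> \<open>The inner factors cancel and leave
    \<open>Y \<otimes> inv (rk X (lk Y X))\<close>, which is trivial since the rack operations are
    inverse to each other.\<close>
  have R2: "rack_\<phi> G lk X Y \<otimes> rack_\<psi> G rk X (lk Y X) = \<one>"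
    if "X \<in> carrier G" "Y \<in> carrier G" for X Y
    using that rk_lk[of X Y]
    by (simp add: rack_\<phi>_def rack_\<psi>_def lk_in_carrier group_word_simps carrier_eq[symmetric])
  \<comment> \<open>Both sides cancel down to \<open>X \<otimes> Y \<otimes> T \<otimes> inv U
    \<otimes> inv (lk Y T) \<otimes> inv T\<close>, where \<open>U\<close> is
    \<open>lk (lk X Y) T\<close> on the left and \<open>lk (lk X T) (lk Y T)\<close> on the right.
    They agree by self-distributivity.\<close>
  have R3: "rack_\<phi> G lk Y X \<otimes> conj_act G Y (rack_\<phi> G lk T (lk X Y)) \<otimes> rack_\<phi> G lk T Y =
      conj_act G X (rack_\<phi> G lk T Y) \<otimes> rack_\<phi> G lk T X \<otimes>
      conj_act G T (rack_\<phi> G lk (lk Y T) (lk X T))"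
    if "X \<in> carrier G" "Y \<in> carrier G" "T \<in> carrier G" for X Y T
    using that lk_distrib[of X Y T]
    by (simp add: rack_\<phi>_def conj_act_def lk_in_carrier group_word_simps carrier_eq[symmetric])
  \<comment> \<open>The left side is \<open>Z \<otimes> A \<otimes> inv (lk Z A)\<close>, so
    cancelling \<open>Z\<close> leaves the fixed-point equation \<open>lk Z A = A\<close>.\<close>
  have f_iff: "id (rack_\<phi> G lk A Z) \<otimes> A = Z \<longleftrightarrow> A = lk Z Z"
    if "A \<in> carrier G" "Z \<in> carrier G" for A Z
  proof -
    have "id (rack_\<phi> G lk A Z) \<otimes> A = Z \<longleftrightarrow> Z \<otimes> (A \<otimes> inv (lk Z A)) = Z \<otimes> \<one>"
      using that by (simp add: rack_\<phi>_def lk_in_carrier group_word_simps)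
    also have "\<dots> \<longleftrightarrow> A \<otimes> inv (lk Z A) = \<one>"
      using that by (intro Units_l_cancel) (simp_all add: lk_in_carrier Units_eq)
    also have "\<dots> \<longleftrightarrow> lk Z A = A"
      using that inv_solve_right'[of \<one> A "lk Z A"] by (auto simp: lk_in_carrier)
    finally show ?thesis using that self_eq_lk_iff by (simp add: carrier_eq)
  qed
  have f_eq: "(THE A. A \<in> carrier G \<and> id (rack_\<phi> G lk A Z) \<otimes> A = Z) = lk Z Z"
    if "Z \<in> carrier G" for Z
    using that by (intro the_equality) (auto simp: f_iff lk_in_carrier simp del: id_apply)
  have g_eq: "inv (id (rack_\<psi> G rk A A)) \<otimes> A = rk A A" if "A \<in> carrier G" for A
    using that by (simp add: rack_\<psi>_def rk_in_carrier group_word_simps)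
  show ?thesis
    unfolding framed_Reidemeister_pair_def Let_def
  proof (intro conjI ballI)
    fix Z assume Z: "Z \<in> carrier G"
    then show "\<exists>!A. A \<in> carrier G \<and> id (rack_\<phi> G lk A Z) \<otimes> A = Z"
      by (intro ex1I[of _ "lk Z Z"]) (auto simp: f_iff lk_in_carrier simp del: id_apply)
    show "(\<lambda>A. inv (id (rack_\<psi> G rk A A)) \<otimes> A)
        (THE A. A \<in> carrier G \<and> id (rack_\<phi> G lk A Z) \<otimes> A = Z) = Z"
      unfolding f_eq[OF Z]
      using Z lk_self_rk_self by (simp add: g_eq lk_in_carrier carrier_eq[symmetric] del: id_apply)
  next
    fix A assume A: "A \<in> carrier G"
    show "(THE B. B \<in> carrier G \<and>
        id (rack_\<phi> G lk B (inv (id (rack_\<psi> G rk A A)) \<otimes> A)) \<otimes> B =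
        inv (id (rack_\<psi> G rk A A)) \<otimes> A) = A"
      unfolding g_eq[OF A] f_eq[OF rk_in_carrier[OF A A]]
      using A rk_self_lk_self by (simp add: carrier_eq)
  qed (simp_all add: rack_\<psi>_closed rack_\<phi>_closed under_neg_rack_\<phi> R2 R3)
qed

section \<open>Counting Reidemeister colourings by rack colourings\<close>

lemma evaluation_trivial:
  assumes "link_diagram D" "(c, d) \<in> Reidemeister_colourings G G id (rack_\<psi> G rk) (rack_\<phi> G lk) D"
  shows "evaluation G G (conj_act G) D (c, d) = \<one>"
proof -
  interpret coloured_diagram G G id "conj_act G" "rack_\<psi> G rk" "rack_\<phi> G lk" D c d
    using assms crossed_module_conj by (simp add: coloured_diagram_def coloured_diagram_axioms_def)
  \<comment> \<open>The kernel of the identity map is trivial.\<close>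
  show ?thesis using evaluation_in_kernel by (simp add: kernel_def)
qed

text \<open>The only crossing part that can accompany the arc colouring \<open>c\<close>; it is
  extensional so that this uniqueness is an equality of functions.\<close>

definition crossing_label :: "diagram \<Rightarrow> (point set \<Rightarrow> 'a) \<Rightarrow> nat \<times> nat \<Rightarrow> 'a" where
  "crossing_label D c = (\<lambda>(i, k)\<in>crossings D.
     if D ! i ! k = X_pos then rack_\<psi> G rk (c (bot_arc D i k 0)) (c (bot_arc D i k 1))
     else rack_\<phi> G lk (c (top_arc D i k 0)) (c (bot_arc D i k 0)))"

lemma Reidemeister_colourings_rack:
  assumes D: "link_diagram D"
  shows "Reidemeister_colourings G G id (rack_\<psi> G rk) (rack_\<phi> G lk) D =
    (\<lambda>c. (c, crossing_label D c)) ` rack_colourings R rk lk D"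
proof -
  have "(c, d) \<in> Reidemeister_colourings G G id (rack_\<psi> G rk) (rack_\<phi> G lk) D \<longleftrightarrow>
    c \<in> rack_colourings R rk lk D \<and> d = crossing_label D c" for c d
  proof (cases "c \<in> arcs D \<rightarrow>\<^sub>E carrier G")
    case False
    then show ?thesis
      by (simp add: Reidemeister_colourings_def rack_colourings_def carrier_eq)
  next
    case True
    have t: "c (top_arc D i k a) \<in> carrier G" and b: "c (bot_arc D i k a) \<in> carrier G"
      if "(i, k) \<in> crossings D" "a < 2" for i k a
      using crossing_arcs[OF D that] True by auto
    have closed: "crossing_label D c \<in> crossings D \<rightarrow>\<^sub>E carrier G"
      by (auto simp: crossing_label_def rack_\<psi>_closed rack_\<phi>_closed t b)
    \<comment> \<open>Both functions are extensional, so agreement on the crossings is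
      equality.\<close>
    have d: "d = crossing_label D c \<longleftrightarrow> d \<in> crossings D \<rightarrow>\<^sub>E carrier G \<and>
      (\<forall>x\<in>crossings D. d x = crossing_label D c x)"
      using closed PiE_ext[of d "crossings D" "\<lambda>_. carrier G" "crossing_label D c"] by auto
    define rack_cond where "rack_cond = (\<lambda>(i, k).
       (D ! i ! k = X_pos \<longrightarrow>
          c (top_arc D i k 0) = rk (c (bot_arc D i k 0)) (c (bot_arc D i k 1))) \<and>
       (D ! i ! k = X_neg \<longrightarrow>
          c (top_arc D i k 1) = lk (c (bot_arc D i k 0)) (c (top_arc D i k 0))))"
    define reid_cond where "reid_cond = (\<lambda>(i, k).
       (D ! i ! k = X_pos \<longrightarrow>
          (let X = c (bot_arc D i k 0); Y = c (bot_arc D i k 1); Z = c (top_arc D i k 0)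
           in d (i, k) = rack_\<psi> G rk X Y \<and> Z = under_pos G id (rack_\<psi> G rk) X Y)) \<and>
       (D ! i ! k = X_neg \<longrightarrow>
          (let X = c (top_arc D i k 0); Y = c (bot_arc D i k 0); Z = c (top_arc D i k 1)
           in d (i, k) = rack_\<phi> G lk X Y \<and> Z = under_neg G id (rack_\<phi> G lk) X Y)))"
    \<comment> \<open>At each crossing the Reidemeister condition splits into the forced label and
      the rack condition on the under arc.\<close>
    have "reid_cond (i, k) \<longleftrightarrow> d (i, k) = crossing_label D c (i, k) \<and> rack_cond (i, k)"
      if x: "(i, k) \<in> crossings D" for i k
      using x t[OF x] b[OF x]
      by (auto elim!: crossingsE simp: rack_cond_def reid_cond_def crossing_label_def
          under_pos_rack_\<psi> under_neg_rack_\<phi> Let_def)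
    then have cond: "(\<forall>x\<in>crossings D. reid_cond x) \<longleftrightarrow>
      (\<forall>x\<in>crossings D. d x = crossing_label D c x) \<and> (\<forall>x\<in>crossings D. rack_cond x)"
      by fast
    have "(c, d) \<in> Reidemeister_colourings G G id (rack_\<psi> G rk) (rack_\<phi> G lk) D \<longleftrightarrow>
        d \<in> crossings D \<rightarrow>\<^sub>E carrier G \<and> (\<forall>x\<in>crossings D. reid_cond x)"
      using True unfolding Reidemeister_colourings_def reid_cond_def by simp
    moreover have "c \<in> rack_colourings R rk lk D \<longleftrightarrow> (\<forall>x\<in>crossings D. rack_cond x)"
      using True unfolding rack_colourings_def rack_cond_def carrier_eq by simp
    ultimately show ?thesis using d cond by argo
  qed
  then show ?thesis by auto
qed

theorem Reidemeister_invariant_rack: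
  assumes "link_diagram D"
  shows "Reidemeister_invariant G G id (conj_act G) (rack_\<psi> G rk) (rack_\<phi> G lk) D =
    frag_cmul (int (rack_invariant R rk lk D)) (frag_of \<one>)"
proof -
  let ?C = "Reidemeister_colourings G G id (rack_\<psi> G rk) (rack_\<phi> G lk) D"
  \<comment> \<open>For infinite \<open>A\<close> both sides vanish, because the sum and
    \<open>card\<close> then default to 0.\<close>
  have const: "(\<Sum>x\<in>A. a) = frag_cmul (int (card A)) a" for A :: "'c set" and a :: "'d \<Rightarrow>\<^sub>0 int"
    by (induction A rule: infinite_finite_induct) (auto simp: frag_cmul_distrib)
  have "card ?C = rack_invariant R rk lk D"
    unfolding Reidemeister_colourings_rack[OF assms] rack_invariant_def
    by (intro card_image inj_onI) simp
  moreover have "Reidemeister_invariant G G id (conj_act G) (rack_\<psi> G rk) (rack_\<phi> G lk) D =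
    (\<Sum>F\<in>?C. frag_of \<one>)"
    unfolding Reidemeister_invariant_def
    using evaluation_trivial[OF assms] by (intro sum.cong) auto
  ultimately show ?thesis by (simp add: const)
qed

end


section \<open>Rack invariants versus Reidemeister invariants\<close>

text \<open>The single colouring is the function that is undefined everywhere; it counts even when
  \<open>R\<close> is empty.\<close>

lemma rack_invariant_no_arcs:
  assumes "link_diagram D" "arcs D = {}"
  shows "rack_invariant R rk lk D = 1"
proof -
  have "crossings D = {}" using crossing_arcs[of D _ _ 0] assms by auto
  then show ?thesis by (simp add: rack_invariant_def rack_colourings_def assms)
qed

lemma rack_invariant_empty: "arcs D \<noteq> {} \<Longrightarrow> rack_invariant {} rk lk D = 0"
proof -
  assume "arcs D \<noteq> {}"
  then have "arcs D \<rightarrow>\<^sub>E ({} :: 'a set) = {}" by (auto simp: PiE_eq_empty_iff)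
  then have "rack_colourings {} rk lk D = {}" unfolding rack_colourings_def by blast
  then show ?thesis by (simp add: rack_invariant_def)
qed

lemma rack_trivial: "rack R (\<lambda>x y. y) (\<lambda>x y. x)"
  by unfold_locales simp_all

text \<open>Constant functions are colourings by a trivial rack, and two of them differ on any
  arc.\<close>

lemma rack_invariant_trivial_neq_1:
  assumes D: "link_diagram D" "arcs D \<noteq> {}" and R: "a \<in> R" "b \<in> R" "a \<noteq> b"
  shows "rack_invariant R (\<lambda>x y. y) (\<lambda>x y. x) D \<noteq> 1"
proof
  have const: "(\<lambda>x\<in>arcs D. u) \<in> rack_colourings R (\<lambda>x y. y) (\<lambda>x y. x) D" if "u \<in> R" for u
    using that crossing_arcs[OF D(1)] by (auto simp: rack_colourings_def)
  assume "rack_invariant R (\<lambda>x y. y) (\<lambda>x y. x) D = 1"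
  then have "(\<lambda>x\<in>arcs D. a) = (\<lambda>x\<in>arcs D. b)"
    using const R(1,2) unfolding rack_invariant_def by (metis card_1_singletonE singletonD)
  with D(2) R(3) show False by (metis equals0I restrict_apply')
qed

text \<open>Rack homomorphisms act on colourings by composition, restricted to the arcs to stay
  extensional.\<close>

lemma rack_colourings_map:
  assumes D: "link_diagram D" and c: "c \<in> rack_colourings R rk lk D"
    and h: "h \<in> R \<rightarrow> R'"
      "\<And>x y. x \<in> R \<Longrightarrow> y \<in> R \<Longrightarrow> h (rk x y) = rk' (h x) (h y)"
      "\<And>x y. x \<in> R \<Longrightarrow> y \<in> R \<Longrightarrow> h (lk x y) = lk' (h x) (h y)"
  shows "compose (arcs D) h c \<in> rack_colourings R' rk' lk' D"
proof -
  have c_in: "c u \<in> R" if "u \<in> arcs D" for u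
    using that c by (auto simp: rack_colourings_def)
  have "compose (arcs D) h c \<in> arcs D \<rightarrow>\<^sub>E R'"
    using c_in h(1) by (auto simp: compose_def)
  moreover have "c (top_arc D i k 0) = rk (c (bot_arc D i k 0)) (c (bot_arc D i k 1))"
    if "(i, k) \<in> crossings D" "D ! i ! k = X_pos" for i k
    using c that by (auto simp: rack_colourings_def)
  moreover have "c (top_arc D i k 1) = lk (c (bot_arc D i k 0)) (c (top_arc D i k 0))"
    if "(i, k) \<in> crossings D" "D ! i ! k = X_neg" for i k
    using c that by (auto simp: rack_colourings_def)
  ultimately show ?thesis
    using c_in h(2,3) crossing_arcs[OF D]
    by (auto simp: rack_colourings_def compose_eq)
qed

lemma rack_invariant_iso:
  assumes D: "link_diagram D" and h: "bij_betw h R R'" and R: "rack R rk lk"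
    and rk: "\<And>x y. x \<in> R \<Longrightarrow> y \<in> R \<Longrightarrow> h (rk x y) = rk' (h x) (h y)"
    and lk: "\<And>x y. x \<in> R \<Longrightarrow> y \<in> R \<Longrightarrow> h (lk x y) = lk' (h x) (h y)"
  shows "rack_invariant R rk lk D = rack_invariant R' rk' lk' D"
proof -
  interpret rack R rk lk by (rule R)
  let ?g = "the_inv_into R h"
  have hR: "h x \<in> R'" if "x \<in> R" for x using h that by (auto simp: bij_betw_def)
  have gR: "?g x \<in> R" "h (?g x) = x" if "x \<in> R'" for x
    using h that the_inv_into_into[of h R x] by (auto simp: bij_betw_def f_the_inv_into_f)
  have gh: "?g (h x) = x" if "x \<in> R" for x
    using h that by (simp add: bij_betw_def the_inv_into_f_f)
  have g_rk: "?g (rk' x y) = rk (?g x) (?g y)" and g_lk: "?g (lk' x y) = lk (?g x) (?g y)"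
    if "x \<in> R'" "y \<in> R'" for x y
    using that gR gh rk[of "?g x" "?g y"] lk[of "?g x" "?g y"] rk_closed lk_closed by metis+
  \<comment> \<open>Colourings are extensional, so the round trip is the identity off the arcs as
    well.\<close>
  have inv: "compose (arcs D) k' (compose (arcs D) k c) = c"
    if "c \<in> rack_colourings S r l D" "\<And>x. x \<in> S \<Longrightarrow> k' (k x) = x"
    for k' :: "'d \<Rightarrow> 'c" and k c S r l
    using that by (auto simp: rack_colourings_def compose_def fun_eq_iff PiE_def extensional_def)
  have "bij_betw (compose (arcs D) h) (rack_colourings R rk lk D) (rack_colourings R' rk' lk' D)"
    by (rule bij_betw_byWitness[where f' = "compose (arcs D) ?g"])
      (use D hR gR gh rk lk g_rk g_lk in \<open>auto intro!: rack_colourings_map inv\<close>)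
  then show ?thesis unfolding rack_invariant_def by (rule bij_betw_same_card)
qed

text \<open>Transport of structure along \<open>h\<close>, which moves a finite rack of any type
  onto an initial segment of the naturals.\<close>

lemma rack_transport:
  assumes "rack R rk lk" and h: "bij_betw h R R'"
  obtains rk' lk' where "rack R' rk' lk'"
    "\<And>D. link_diagram D \<Longrightarrow> rack_invariant R' rk' lk' D = rack_invariant R rk lk D"
proof -
  interpret rack R rk lk by (rule assms(1))
  let ?g = "the_inv_into R h"
  have hR: "h x \<in> R'" if "x \<in> R" for x using h that by (auto simp: bij_betw_def)
  have gR: "?g x \<in> R" "h (?g x) = x" if "x \<in> R'" for x
    using h that the_inv_into_into[of h R x] by (auto simp: bij_betw_def f_the_inv_into_f)
  have gh: "?g (h x) = x" if "x \<in> R" for x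
    using h that by (simp add: bij_betw_def the_inv_into_f_f)
  define rk' where "rk' x y = h (rk (?g x) (?g y))" for x y
  define lk' where "lk' x y = h (lk (?g x) (?g y))" for x y
  have "rack R' rk' lk'"
    by unfold_locales
      (simp_all add: rk'_def lk'_def hR gR gh rk_closed lk_closed rk_lk lk_rk
        rk_distrib[symmetric] lk_distrib[symmetric])
  moreover have "rack_invariant R' rk' lk' D = rack_invariant R rk lk D" if "link_diagram D" for D
    using rack_invariant_iso[OF that h assms(1), of rk' lk'] by (simp add: rk'_def lk'_def gh)
  ultimately show thesis by (rule that)
qed

text \<open>Positivity of \<open>n\<close> ensures that \<open>{..<n}\<close> carries a group
  structure; this is why the empty rack has to be replaced by another rack.\<close>

lemma nat_rack_at_least_as_strong:
  fixes R :: "'a set"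
  assumes R: "rack R rk lk" "finite R"
  obtains n rk' lk' where "0 < n" "rack {..<n::nat} rk' lk'"
    "\<And>D D'. link_diagram D \<Longrightarrow> link_diagram D' \<Longrightarrow>
      rack_invariant {..<n} rk' lk' D = rack_invariant {..<n} rk' lk' D' \<Longrightarrow>
      rack_invariant R rk lk D = rack_invariant R rk lk D'"
proof (cases "R = {}")
  case True
  \<comment> \<open>The trivial rack on two elements has exactly one colouring if and only if there
    is no arc.\<close>
  have "arcs D = {} \<longleftrightarrow> rack_invariant {..<2::nat} (\<lambda>x y. y) (\<lambda>x y. x) D = 1" if "link_diagram D" for D
    using rack_invariant_no_arcs[OF that, of "{..<2::nat}" "\<lambda>x y. y" "\<lambda>x y. x"]
      rack_invariant_trivial_neq_1[OF that, of "0::nat" "{..<2}" "1::nat"]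
    by (cases "arcs D = {}") simp_all
  moreover have "rack_invariant R rk lk D = (if arcs D = {} then 1 else 0)" if "link_diagram D" for D
    using that by (simp add: True rack_invariant_no_arcs rack_invariant_empty)
  ultimately show thesis
    by (intro that[of 2 "\<lambda>x y. y" "\<lambda>x y. x"] rack_trivial) auto
next
  case False
  obtain h where "bij_betw h R {..<card R}"
    using R(2) ex_bij_betw_finite_nat by (metis atLeast0LessThan)
  from rack_transport[OF R(1) this] obtain rk' lk' where "rack {..<card R} rk' lk'"
    "\<And>D. link_diagram D \<Longrightarrow> rack_invariant {..<card R} rk' lk' D = rack_invariant R rk lk D"
    by blast
  then show thesis using False R(2) by (intro that[of "card R" rk' lk']) (auto simp: card_gt_0_iff)
qed

lemma ex_group_lessThan:
  assumes "0 < n"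
  shows "\<exists>G :: nat monoid. group G \<and> carrier G = {..<n}"
proof (intro exI conjI)
  let ?G = "\<lparr>carrier = {..<n}, mult = \<lambda>x y. (x + y) mod n, one = 0\<rparr>"
  show "group ?G"
  proof (rule groupI)
    fix x assume "x \<in> carrier ?G"
    then show "\<exists>y\<in>carrier ?G. y \<otimes>\<^bsub>?G\<^esub> x = \<one>\<^bsub>?G\<^esub>"
      \<comment> \<open>The outer \<open>mod n\<close> matters for \<open>x = 0\<close>, where
        \<open>n - x\<close> lies outside the carrier.\<close>
      using assms by (intro bexI[of _ "(n - x) mod n"]) (simp_all add: mod_add_left_eq)
  qed (use assms in \<open>simp_all add: mod_add_left_eq mod_add_right_eq add.assoc\<close>)
qed simp

theorem theorem4p4:
  fixes R :: "'a set" and rk lk :: "'a \<Rightarrow> 'a \<Rightarrow> 'a"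
  assumes "rack R rk lk" and "finite R"
  shows "(\<forall>G :: 'a monoid. group G \<and> carrier G = R \<longrightarrow>
            crossed_module G G id (conj_act G) \<and>
            framed_Reidemeister_pair G G id (conj_act G) (rack_\<psi> G rk) (rack_\<phi> G lk) \<and>
            (\<forall>D. link_diagram D \<longrightarrow>
               Reidemeister_invariant G G id (conj_act G) (rack_\<psi> G rk) (rack_\<phi> G lk) D =
               frag_cmul (int (rack_invariant R rk lk D)) (frag_of \<one>\<^bsub>G\<^esub>))) \<and>
         (\<exists>(P :: nat monoid) (H :: nat monoid) \<mu> act \<psi> \<phi>.
            crossed_module P H \<mu> act \<and> finite (carrier H) \<and>
            framed_Reidemeister_pair P H \<mu> act \<psi> \<phi> \<and>
            (\<forall>D D'. link_diagram D \<and> link_diagram D' \<and>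
               rack_invariant R rk lk D \<noteq> rack_invariant R rk lk D' \<longrightarrow>
               Reidemeister_invariant P H \<mu> act \<psi> \<phi> D \<noteq>
               Reidemeister_invariant P H \<mu> act \<psi> \<phi> D'))"
proof (intro conjI allI impI)
  fix G :: "'a monoid" assume "group G \<and> carrier G = R"
  then interpret rack_group R rk lk G
    using assms(1) by (simp add: rack_group_def rack_group_axioms_def)
  show "crossed_module G G id (conj_act G)"
    by (rule crossed_module_conj)
  show "framed_Reidemeister_pair G G id (conj_act G) (rack_\<psi> G rk) (rack_\<phi> G lk)"
    by (rule framed_Reidemeister_pair_rack)
  show "Reidemeister_invariant G G id (conj_act G) (rack_\<psi> G rk) (rack_\<phi> G lk) D =
      frag_cmul (int (rack_invariant R rk lk D)) (frag_of \<one>\<^bsub>G\<^esub>)" if "link_diagram D" for D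
    using that by (rule Reidemeister_invariant_rack)
next
  obtain n rk' lk' where n: "0 < n" "rack {..<n::nat} rk' lk'"
    and strong: "\<And>D D'. link_diagram D \<Longrightarrow> link_diagram D' \<Longrightarrow>
      rack_invariant {..<n} rk' lk' D = rack_invariant {..<n} rk' lk' D' \<Longrightarrow>
      rack_invariant R rk lk D = rack_invariant R rk lk D'"
    using nat_rack_at_least_as_strong[OF assms] by blast
  obtain G :: "nat monoid" where "group G" "carrier G = {..<n}"
    using ex_group_lessThan[OF n(1)] by blast
  then interpret rack_group "{..<n}" rk' lk' G
    using n(2) by (simp add: rack_group_def rack_group_axioms_def)
  \<comment> \<open>Compare coefficients at the identity: the Reidemeister invariant retains the
    full count of rack colourings.\<close>
  have "frag_cmul (int a) (frag_of \<one>\<^bsub>G\<^esub>) = frag_cmul (int b) (frag_of \<one>\<^bsub>G\<^esub>) \<longleftrightarrow> a = b" for a b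
    by (metis lookup_frag_cmul lookup_frag_of mult.right_neutral of_nat_eq_iff)
  then have "\<forall>D D'. link_diagram D \<and> link_diagram D' \<and>
      rack_invariant R rk lk D \<noteq> rack_invariant R rk lk D' \<longrightarrow>
      Reidemeister_invariant G G id (conj_act G) (rack_\<psi> G rk') (rack_\<phi> G lk') D \<noteq>
      Reidemeister_invariant G G id (conj_act G) (rack_\<psi> G rk') (rack_\<phi> G lk') D'"
    using strong by (auto simp: Reidemeister_invariant_rack)
  then show "\<exists>(P :: nat monoid) (H :: nat monoid) \<mu> act \<psi> \<phi>.
      crossed_module P H \<mu> act \<and> finite (carrier H) \<and> framed_Reidemeister_pair P H \<mu> act \<psi> \<phi> \<and>
      (\<forall>D D'. link_diagram D \<and> link_diagram D' \<and>
         rack_invariant R rk lk D \<noteq> rack_invariant R rk lk D' \<longrightarrow>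
         Reidemeister_invariant P H \<mu> act \<psi> \<phi> D \<noteq> Reidemeister_invariant P H \<mu> act \<psi> \<phi> D')"
    using crossed_module_conj framed_Reidemeister_pair_rack carrier_eq by (metis finite_lessThan)
qed

end
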